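(* Let $n\ge 3$, let $P_n(R)$ be a regular $n$-gon in the Euclidean plane with vertices $A_1,\dots,A_n$, circumradius $R>0$ and centroid $O$. Let $m\in\{1,2,\dots,n-1\}$ and let $c$ be a real constant with $c>nR^{2m}$. Then the locus of points $M$ of the plane such that $$\sum_{i=1}^n d_i^{2m}=c,\qquad d_i=|MA_i|,$$ is a circle whose center is the centroid $O$ of $P_n(R)$.
   Context: $|MA_i|$ denotes the Euclidean distance from $M$ to $A_i$. A circle means a circle of positive radius. *)

theory Defs
  imports "HOL-Analysis.Analysis"
begin

text \<open>
  An \<open>n\<close>-gon is given by its vertices \<open>A 1, \<dots>, A n\<close>, listed in cyclic order (in either
  orientation); values of \<open>A\<close> outside \<open>{1..n}\<close> are irrelevant.
\<close>

text \<open>The cyclic successor on \<open>{1..n}\<close>: \<open>i + 1\<close> for \<open>i < n\<close>, and \<open>1\<close> for \<open>i = n\<close>.\<close>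

definition next_vertex :: "nat \<Rightarrow> nat \<Rightarrow> nat" where
  "next_vertex n i = i mod n + 1"

text \<open>
  Convexity: for each side, all the remaining vertices lie strictly on one side of the line
  through it (\<open>v\<close> is a normal vector of that line). Since \<open>n \<ge> 3\<close>, this entails that the vertices
  are pairwise distinct, and it excludes star polygons and collinear consecutive vertices.
\<close>

definition convex_polygon :: "nat \<Rightarrow> (nat \<Rightarrow> real^2) \<Rightarrow> bool" where
  "convex_polygon n A \<longleftrightarrow> n \<ge> 3 \<and>
     (\<forall>i\<in>{1..n}. \<exists>v. v \<bullet> (A (next_vertex n i) - A i) = 0 \<and>
        (\<forall>j\<in>{1..n} - {i, next_vertex n i}. v \<bullet> (A j - A i) > 0))"

text \<open>The unoriented angle \<open>PQS\<close> in \<open>[0, pi]\<close>; meaningful for \<open>P \<noteq> Q\<close> and \<open>S \<noteq> Q\<close>.\<close>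

definition vertex_angle :: "real^2 \<Rightarrow> real^2 \<Rightarrow> real^2 \<Rightarrow> real" where
  "vertex_angle P Q S = arccos (((P - Q) \<bullet> (S - Q)) / (norm (P - Q) * norm (S - Q)))"

definition equilateral :: "nat \<Rightarrow> (nat \<Rightarrow> real^2) \<Rightarrow> bool" where
  "equilateral n A \<longleftrightarrow>
     (\<forall>i\<in>{1..n}. \<forall>j\<in>{1..n}.
        dist (A i) (A (next_vertex n i)) = dist (A j) (A (next_vertex n j)))"

text \<open>
  The interior angle at the vertex following \<open>A i\<close>; for a convex polygon it is the unoriented
  angle between the two sides meeting there.
\<close>

definition interior_angle :: "nat \<Rightarrow> (nat \<Rightarrow> real^2) \<Rightarrow> nat \<Rightarrow> real" where
  "interior_angle n A i =
     vertex_angle (A i) (A (next_vertex n i)) (A (next_vertex n (next_vertex n i)))"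

definition equiangular :: "nat \<Rightarrow> (nat \<Rightarrow> real^2) \<Rightarrow> bool" where
  "equiangular n A \<longleftrightarrow>
     (\<forall>i\<in>{1..n}. \<forall>j\<in>{1..n}. interior_angle n A i = interior_angle n A j)"

definition regular_polygon :: "nat \<Rightarrow> (nat \<Rightarrow> real^2) \<Rightarrow> bool" where
  "regular_polygon n A \<longleftrightarrow> convex_polygon n A \<and> equilateral n A \<and> equiangular n A"

text \<open>\<open>R\<close> is the radius of a circle through all vertices.\<close>

definition has_circumradius :: "nat \<Rightarrow> (nat \<Rightarrow> real^2) \<Rightarrow> real \<Rightarrow> bool" where
  "has_circumradius n A R \<longleftrightarrow> (\<exists>P. \<forall>i\<in>{1..n}. A i \<in> sphere P R)"

definition centroid :: "nat \<Rightarrow> (nat \<Rightarrow> real^2) \<Rightarrow> real^2" where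
  "centroid n A = (1 / real n) *\<^sub>R (\<Sum>i=1..n. A i)"

end

theory Submission
  imports Defs
begin

text \<open>
  Identify the plane with the complex numbers, with the circumcentre at \<open>0\<close>. Consecutive sides
  have the same length and the vertices are distinct, so the quotient \<open>w\<close> of consecutive vertices
  is constant, and \<open>w\<close> is a primitive \<open>n\<close>-th root of unity. Expanding
  \<open>\<bar>x - z\<bar>\<^sup>2\<^sup>m = (x - z)\<^sup>m (cnj x - cnj z)\<^sup>m\<close> and summing over the vertices \<open>z\<close>, every mixed term
  \<open>z\<^sup>j (cnj z)\<^sup>l\<close> with \<open>j \<noteq> l\<close> vanishes because \<open>\<bar>j - l\<bar> \<le> m < n\<close>. What remains is a polynomial
  in \<open>\<bar>x\<bar>\<^sup>2\<close> with positive coefficients and value \<open>n R\<^sup>2\<^sup>m\<close> at \<open>0\<close>; on \<open>[0, \<infinity>)\<close> it takes the value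
  \<open>c\<close> exactly once.
\<close>

section \<open>Power sums over regular polygons in the complex plane\<close>

lemma sum_powers_root_of_unity:
  fixes w :: "'a::field"
  assumes "w ^ n = 1" "w ^ j \<noteq> 1"
  shows "(\<Sum>k<n. (w ^ k) ^ j) = 0"
proof -
  have "(\<Sum>k<n. (w ^ k) ^ j) = (\<Sum>k<n. (w ^ j) ^ k)"
    by (simp add: mult.commute flip: power_mult)
  also have "\<dots> = ((w ^ j) ^ n - 1) / (w ^ j - 1)"
    using assms(2) by (rule geometric_sum)
  also have "(w ^ j) ^ n = 1"
    using assms(1) by (metis mult.commute power_mult power_one)
  finally show ?thesis by simp
qed

text \<open>For \<open>l < j\<close> each term is \<open>\<bar>b\<bar>^(2*l)\<close> times
  \<open>(b * w ^ k) ^ (j - l)\<close>, because \<open>\<bar>w\<bar> = 1\<close>. What is left is a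
  geometric sum with ratio \<open>w ^ (j - l) \<noteq> 1\<close>, as \<open>0 < j - l < n\<close>.
  The case \<open>j < l\<close> follows by conjugation.\<close>

lemma sum_mixed_powers_eq_0:
  fixes w b :: complex
  assumes "w ^ n = 1" "\<And>j. \<lbrakk>0 < j; j < n\<rbrakk> \<Longrightarrow> w ^ j \<noteq> 1"
    and norm_w: "cmod w = 1" and "j < n" "l < n" "j \<noteq> l"
  shows "(\<Sum>k<n. (b * w ^ k) ^ j * cnj (b * w ^ k) ^ l) = 0"
proof -
  have *: "(\<Sum>k<n. (b * w ^ k) ^ j * cnj (b * w ^ k) ^ l) = 0" if "l < j" "j < n" for j l
  proof -
    have "(b * w ^ k) ^ j * cnj (b * w ^ k) ^ l
        = of_real (cmod b ^ 2) ^ l * b ^ (j - l) * (w ^ k) ^ (j - l)" for k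
    proof -
      let ?z = "b * w ^ k"
      have "?z ^ j * cnj ?z ^ l = (?z * cnj ?z) ^ l * ?z ^ (j - l)"
      proof -
        have "?z ^ j = ?z ^ l * ?z ^ (j - l)"
          using that by (simp flip: power_add)
        then have "?z ^ j * cnj ?z ^ l = ?z ^ l * cnj ?z ^ l * ?z ^ (j - l)" by (simp only: mult_ac)
        then show ?thesis unfolding power_mult_distrib[of ?z "cnj ?z"] .
      qed
      also have "?z * cnj ?z = of_real (cmod b ^ 2)"
        unfolding complex_norm_square[symmetric]
        by (simp add: norm_mult norm_power norm_w)
      finally show ?thesis by (simp add: power_mult_distrib)
    qed
    then have "(\<Sum>k<n. (b * w ^ k) ^ j * cnj (b * w ^ k) ^ l)
        = of_real (cmod b ^ 2) ^ l * b ^ (j - l) * (\<Sum>k<n. (w ^ k) ^ (j - l))"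
      by (simp add: sum_distrib_left)
    also have "(\<Sum>k<n. (w ^ k) ^ (j - l)) = 0"
      using assms(1,2) that by (intro sum_powers_root_of_unity) auto
    finally show ?thesis by simp
  qed
  show ?thesis
  proof (cases "l < j")
    case True
    then show ?thesis using * assms by blast
  next
    case False
    then have "(\<Sum>k<n. (b * w ^ k) ^ l * cnj (b * w ^ k) ^ j) = 0"
      using * assms by simp
    then have "cnj (\<Sum>k<n. (b * w ^ k) ^ l * cnj (b * w ^ k) ^ j) = 0" by simp
    then show ?thesis by (simp add: mult.commute)
  qed
qed

text \<open>The point of the formula is that \<open>x\<close> enters only through its modulus, so
  level sets of the power sum are unions of circles about 0, possibly with 0 itself.\<close>

lemma sum_dist_powers_regular:
  fixes w b x :: complex
  assumes "w ^ n = 1" "\<And>j. \<lbrakk>0 < j; j < n\<rbrakk> \<Longrightarrow> w ^ j \<noteq> 1" "cmod w = 1" "m < n"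
  shows "(\<Sum>k<n. cmod (x - b * w ^ k) ^ (2 * m))
       = n * (\<Sum>j\<le>m. real (m choose j) ^ 2 * (cmod x ^ 2) ^ (m - j) * (cmod b ^ 2) ^ j)"
proof -
  \<comment> \<open>The sign is absorbed into \<open>?z\<close>, so that the binomial theorem
    applies to \<open>?z k + x\<close>; the vanishing of mixed sums is then used with
    \<open>- b\<close>.\<close>
  let ?z = "\<lambda>k. - b * w ^ k"
  let ?c = "\<lambda>j l. of_nat (m choose j) * of_nat (m choose l) * x ^ (m - j) * cnj x ^ (m - l)"
  let ?S = "\<lambda>j l. \<Sum>k<n. ?z k ^ j * cnj (?z k) ^ l"
  have expand: "complex_of_real (cmod (x - b * w ^ k) ^ (2 * m))
      = (\<Sum>j\<le>m. \<Sum>l\<le>m. ?c j l * (?z k ^ j * cnj (?z k) ^ l))" for k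
  proof -
    have "complex_of_real (cmod (x - b * w ^ k) ^ (2 * m))
        = ((x - b * w ^ k) * cnj (x - b * w ^ k)) ^ m"
      unfolding complex_norm_square[symmetric] by (simp add: power_mult)
    also have "\<dots> = (?z k + x) ^ m * (cnj (?z k) + cnj x) ^ m"
      by (simp add: power_mult_distrib)
    also have "\<dots> = (\<Sum>j\<le>m. \<Sum>l\<le>m. ?c j l * (?z k ^ j * cnj (?z k) ^ l))"
      unfolding binomial_ring sum_product by (intro sum.cong refl) (simp add: mult_ac)
    finally show ?thesis .
  qed
  have off_diag: "?S j l = 0" if "j \<le> m" "l \<le> m" "j \<noteq> l" for j l
    using sum_mixed_powers_eq_0[of w n j l "- b"] assms that by simp
  have diag: "?S j j = of_nat n * of_real ((cmod b ^ 2) ^ j)" for j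
  proof -
    have "?z k ^ j * cnj (?z k) ^ j = of_real ((cmod b ^ 2) ^ j)" for k
    proof -
      have "?z k ^ j * cnj (?z k) ^ j = (?z k * cnj (?z k)) ^ j"
        by (simp only: power_mult_distrib)
      also have "\<dots> = of_real ((cmod b ^ 2) ^ j)"
        unfolding complex_norm_square[symmetric]
        by (simp add: norm_mult norm_power assms(3))
      finally show ?thesis .
    qed
    then show ?thesis by simp
  qed
  have "complex_of_real (\<Sum>k<n. cmod (x - b * w ^ k) ^ (2 * m))
      = (\<Sum>k<n. \<Sum>j\<le>m. \<Sum>l\<le>m. ?c j l * (?z k ^ j * cnj (?z k) ^ l))"
    by (simp only: of_real_sum expand)
  also have "\<dots> = (\<Sum>j\<le>m. \<Sum>k<n. \<Sum>l\<le>m. ?c j l * (?z k ^ j * cnj (?z k) ^ l))"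
    by (rule sum.swap)
  also have "\<dots> = (\<Sum>j\<le>m. \<Sum>l\<le>m. \<Sum>k<n. ?c j l * (?z k ^ j * cnj (?z k) ^ l))"
    by (intro sum.cong refl sum.swap)
  also have "\<dots> = (\<Sum>j\<le>m. \<Sum>l\<le>m. ?c j l * ?S j l)"
    by (simp only: sum_distrib_left)
  also have "\<dots> = (\<Sum>j\<le>m. \<Sum>l\<le>m. if l = j then ?c j j * ?S j j else 0)"
    by (intro sum.cong refl) (use off_diag in auto)
  also have "\<dots> = (\<Sum>j\<le>m. ?c j j * ?S j j)"
    by (intro sum.cong refl) (simp only: sum.delta' sum.delta finite_atMost if_True)
  also have "\<dots> = (\<Sum>j\<le>m. of_nat n * of_real (real (m choose j) ^ 2 * (cmod x ^ 2) ^ (m - j)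
                    * (cmod b ^ 2) ^ j))"
  proof (intro sum.cong refl)
    fix j
    have "x ^ (m - j) * cnj x ^ (m - j) = of_real ((cmod x ^ 2) ^ (m - j))"
      unfolding of_real_power[of _ "m - j"] complex_norm_square power_mult_distrib ..
    then have "?c j j = of_real (real (m choose j) ^ 2 * (cmod x ^ 2) ^ (m - j))"
      by (simp add: power2_eq_square mult.assoc)
    then show "?c j j * ?S j j = of_nat n * of_real (real (m choose j) ^ 2 * (cmod x ^ 2) ^ (m - j)
                    * (cmod b ^ 2) ^ j)"
      unfolding diag by simp
  qed
  also have "\<dots> = complex_of_real
      (n * (\<Sum>j\<le>m. real (m choose j) ^ 2 * (cmod x ^ 2) ^ (m - j) * (cmod b ^ 2) ^ j))"
    by (simp add: sum_distrib_left)
  finally show ?thesis by (simp only: of_real_eq_iff)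
qed

section \<open>Vertices of a regular polygon\<close>

text \<open>Dividing by \<open>b\<close> moves the middle point to 1 on the unit circle. Two
  distinct unit points equidistant from 1 are conjugate, hence have product 1.\<close>

lemma equal_chords_geometric:
  fixes a b d :: complex
  assumes "cmod a = R" "cmod b = R" "cmod d = R" "R > 0"
    and chords: "cmod (b - a) = cmod (d - b)" and "a \<noteq> d"
  shows "a * d = b ^ 2"
proof -
  define u v where "u = a / b" and "v = d / b"
  have b: "b \<noteq> 0" using assms by auto
  have u: "cmod u = 1" and v: "cmod v = 1"
    using assms by (auto simp: u_def v_def norm_divide)
  have "u \<noteq> v" using b \<open>a \<noteq> d\<close> by (simp add: u_def v_def)
  have "cmod (u - 1) = cmod (b - a) / cmod b" "cmod (v - 1) = cmod (d - b) / cmod b"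
    using b by (simp_all add: u_def v_def norm_minus_commute diff_divide_distrib flip: norm_divide)
  then have "(cmod (u - 1))\<^sup>2 = (cmod (v - 1))\<^sup>2" using chords by simp
  moreover have *: "(Re u)\<^sup>2 + (Im u)\<^sup>2 = 1" "(Re v)\<^sup>2 + (Im v)\<^sup>2 = 1"
    using u v by (metis cmod_power2 one_power2)+
  \<comment> \<open>On the unit circle, the squared distance from \<open>u\<close> to 1 is
    \<open>2 - 2 * Re u\<close>.\<close>
  ultimately have re: "Re u = Re v"
    by (simp add: cmod_power2 power2_diff)
  with * have "(Im u)\<^sup>2 = (Im v)\<^sup>2" by simp
  with re \<open>u \<noteq> v\<close> have "Im u = - Im v"
    by (auto simp: power2_eq_iff complex_eq_iff)
  with re have "u = cnj v" by (simp add: complex_eq_iff)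
  then have "u * v = 1" using v by (metis complex_norm_square mult.commute of_real_1 one_power2)
  then show ?thesis using b by (simp add: u_def v_def power2_eq_square field_simps)
qed

text \<open>Consecutive triples are in geometric progression, so the ratio \<open>w\<close> is
  constant. Periodicity gives \<open>w ^ n = 1\<close>, and injectivity on one period makes
  \<open>w\<close> primitive.\<close>

lemma equal_chords_imp_root_of_unity:
  fixes B :: "nat \<Rightarrow> complex"
  assumes "R > 0" "n \<ge> 3" and norm_B: "\<And>k. cmod (B k) = R"
    and chords: "\<And>k. cmod (B (Suc k) - B k) = s"
    and periodic: "\<And>k. B (k + n) = B k"
    and inj: "inj_on (\<lambda>k. B (k mod n)) {..<n}"
  obtains w where "\<And>k. B k = B 0 * w ^ k" "w ^ n = 1" "cmod w = 1"
    "\<And>j. \<lbrakk>0 < j; j < n\<rbrakk> \<Longrightarrow> w ^ j \<noteq> 1"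
proof -
  have B0: "B k \<noteq> 0" for k using norm_B[of k] \<open>R > 0\<close> by auto
  have Bmod: "B k = B (k mod n)" for k
  proof (induction k rule: less_induct)
    case (less k)
    show ?case
    proof (cases "k < n")
      case False
      then have "B k = B (k - n)" using periodic[of "k - n"] by simp
      also have "\<dots> = B ((k - n) mod n)" using less False \<open>n \<ge> 3\<close> by simp
      finally show ?thesis using False by (simp add: le_mod_geq)
    qed simp
  qed
  have inj': "k mod n = l mod n" if "B k = B l" for k l
  proof -
    have "B (k mod n mod n) = B (l mod n mod n)" using that Bmod[of k] Bmod[of l] by simp
    then show ?thesis using inj_onD[OF inj] \<open>n \<ge> 3\<close> by simp
  qed
  \<comment> \<open>This excludes stepping back along the same chord; it holds because
    \<open>n \<ge> 3\<close> does not divide 2.\<close>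
  have "B k \<noteq> B (Suc (Suc k))" for k
  proof
    assume "B k = B (Suc (Suc k))"
    then have "k mod n = (k + 2) mod n" using inj'[of k "k + 2"] by simp
    then have "n dvd 2" using mod_eq_dvd_iff_nat[of k "k + 2" n] by simp
    then show False using \<open>n \<ge> 3\<close> by (auto dest: dvd_imp_le)
  qed
  then have geo: "B k * B (Suc (Suc k)) = B (Suc k) ^ 2" for k
    using norm_B \<open>R > 0\<close> by (intro equal_chords_geometric) (auto simp: chords)
  define w where "w = B 1 / B 0"
  have ratio: "B (Suc k) = w * B k" for k
  proof (induction k)
    case (Suc k)
    have "B k * B (Suc (Suc k)) = B k * (w * B (Suc k))"
      using geo[of k] Suc by (simp add: power2_eq_square mult_ac)
    then show ?case using B0[of k] by simp
  qed (use B0 in \<open>simp add: w_def\<close>)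
  have B: "B k = B 0 * w ^ k" for k
    by (induction k) (simp_all add: ratio)
  show ?thesis
  proof
    show "w ^ n = 1" using B[of n] periodic[of 0] B0[of 0] by simp
    show "cmod w = 1" using norm_B \<open>R > 0\<close> by (simp add: w_def norm_divide)
    show "w ^ j \<noteq> 1" if "0 < j" "j < n" for j
      using inj'[of j 0] B[of j] that by auto
  qed (rule B)
qed

text \<open>Convexity separates a vertex from all others except its successor. Coinciding vertices
  would thus be successors of each other, which is impossible in a cycle of length at least
  3.\<close>

lemma convex_polygon_vertices_inj:
  assumes "convex_polygon n A"
  shows "inj_on A {1..n}"
proof (rule inj_onI, rule ccontr)
  fix i j assume ij: "i \<in> {1..n}" "j \<in> {1..n}" "A i = A j" "i \<noteq> j"
  have n: "n \<ge> 3" using assms by (simp add: convex_polygon_def)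
  have sep: "A l \<noteq> A k" if "k \<in> {1..n}" "l \<in> {1..n}" "l \<noteq> k" "l \<noteq> next_vertex n k" for k l
  proof -
    obtain v where "\<forall>j\<in>{1..n} - {k, next_vertex n k}. v \<bullet> (A j - A k) > 0"
      using assms \<open>k \<in> {1..n}\<close> unfolding convex_polygon_def by blast
    then have "v \<bullet> (A l - A k) > 0" using that by blast
    then show ?thesis by auto
  qed
  have "j = next_vertex n i" "i = next_vertex n j"
    using sep[of i j] sep[of j i] ij by auto
  moreover have "next_vertex n k = (if k = n then 1 else k + 1)" if "k \<in> {1..n}" for k
    using that by (simp add: next_vertex_def)
  ultimately have "j = (if i = n then 1 else i + 1)" "i = (if j = n then 1 else j + 1)"
    using ij by metis+
  then show False
    using n by presburger
qed

section \<open>Passage from \<open>real^2\<close> to the complex plane\<close>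

definition complex_of_vec :: "real^2 \<Rightarrow> complex" where
  "complex_of_vec v = Complex (v $ 1) (v $ 2)"

lemma complex_of_vec_diff: "complex_of_vec (u - v) = complex_of_vec u - complex_of_vec v"
  by (simp add: complex_of_vec_def complex_eq_iff)

lemma complex_of_vec_sum: "complex_of_vec (\<Sum>i\<in>I. f i) = (\<Sum>i\<in>I. complex_of_vec (f i))"
  by (simp add: complex_of_vec_def complex_eq_iff)

lemma cmod_complex_of_vec: "cmod (complex_of_vec v) = norm v"
  by (simp add: complex_of_vec_def cmod_def norm_vec_def L2_set_def UNIV_2)

lemma dist_eq_cmod: "dist u v = cmod (complex_of_vec (u - P) - complex_of_vec (v - P))"
  by (simp add: dist_norm cmod_complex_of_vec flip: complex_of_vec_diff)

lemma sum_shift_cyclic: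
  fixes f :: "nat \<Rightarrow> 'a::comm_monoid_add"
  shows "(\<Sum>i=1..n. f i) = (\<Sum>k<n. f (k mod n + 1))"
proof -
  have "(\<Sum>i=1..n. f i) = (\<Sum>k<n. f (Suc k))"
    by (rule sum.reindex_bij_witness[of _ Suc "\<lambda>i. i - 1"]) auto
  then show ?thesis by simp
qed

lemma regular_polygon_power_sum:
  fixes A :: "nat \<Rightarrow> real^2"
  assumes "regular_polygon n A" "has_circumradius n A R" "R > 0" "m < n"
  shows "(\<Sum>i=1..n. dist M (A i) ^ (2 * m))
       = n * (\<Sum>j\<le>m. real (m choose j) ^ 2 * (dist (centroid n A) M ^ 2) ^ (m - j) * (R ^ 2) ^ j)"
proof -
  have cp: "convex_polygon n A" and eq: "equilateral n A"
    using assms by (auto simp: regular_polygon_def)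
  have n: "n \<ge> 3" using cp by (simp add: convex_polygon_def)
  obtain P where P: "\<And>i. i \<in> {1..n} \<Longrightarrow> dist P (A i) = R"
    using assms(2) unfolding has_circumradius_def mem_sphere by blast
  \<comment> \<open>The vertices seen from the circumcentre, reindexed from 0 and extended
    periodically, so that the closing side is no special case.\<close>
  define B where "B k = complex_of_vec (A (k mod n + 1) - P)" for k
  have idx: "k mod n + 1 \<in> {1..n}" for k
    using n by (simp add: Suc_leI)
  have norm_B: "cmod (B k) = R" for k
    using P[OF idx] by (simp add: B_def cmod_complex_of_vec dist_norm norm_minus_commute)
  have next_vertex: "next_vertex n (k mod n + 1) = Suc k mod n + 1" for k
    by (simp add: next_vertex_def mod_Suc_eq)
  have chords: "cmod (B (Suc k) - B k) = dist (A 1) (A (next_vertex n 1))" for k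
  proof -
    have "cmod (B (Suc k) - B k) = dist (A (k mod n + 1)) (A (next_vertex n (k mod n + 1)))"
      unfolding next_vertex B_def by (simp add: dist_eq_cmod[where P = P] norm_minus_commute)
    also have "\<dots> = dist (A 1) (A (next_vertex n 1))"
      using eq idx[of k] n unfolding equilateral_def by force
    finally show ?thesis .
  qed
  have inj: "inj_on (\<lambda>k. B (k mod n)) {..<n}"
  proof (rule inj_onI)
    fix k l assume kl: "k \<in> {..<n}" "l \<in> {..<n}" "B (k mod n) = B (l mod n)"
    then have "dist (A (k mod n + 1)) (A (l mod n + 1)) = 0"
      by (simp add: dist_eq_cmod[where P = P] B_def)
    then have "A (k mod n + 1) = A (l mod n + 1)" by simp
    then have "k mod n + 1 = l mod n + 1"
      using inj_onD[OF convex_polygon_vertices_inj[OF cp]] idx by blast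
    with kl show "k = l" by simp
  qed
  obtain w where w: "\<And>k. B k = B 0 * w ^ k" "w ^ n = 1" "cmod w = 1"
    "\<And>j. \<lbrakk>0 < j; j < n\<rbrakk> \<Longrightarrow> w ^ j \<noteq> 1"
    using equal_chords_imp_root_of_unity[OF \<open>R > 0\<close> n norm_B chords _ inj]
    by (auto simp: B_def)
  \<comment> \<open>The centred vertices are \<open>B 0 * w ^ k\<close>, and the powers of
    \<open>w \<noteq> 1\<close> over one period sum to 0.\<close>
  have "centroid n A = P"
  proof -
    have "complex_of_vec (\<Sum>i=1..n. A i - P) = (\<Sum>k<n. B k)"
      unfolding complex_of_vec_sum B_def by (rule sum_shift_cyclic)
    also have "\<dots> = B 0 * (\<Sum>k<n. (w ^ k) ^ 1)"
      by (subst w(1)) (simp add: sum_distrib_left)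
    also have "\<dots> = 0"
      using sum_powers_root_of_unity[OF w(2), of 1] w(4)[of 1] n by simp
    finally have "(\<Sum>i=1..n. A i - P) = 0"
      using cmod_complex_of_vec by (metis norm_eq_zero)
    then have "(\<Sum>i=1..n. A i) = real n *\<^sub>R P"
      by (simp add: sum_subtractf sum_constant_scaleR del: sum_constant)
    then show ?thesis using n by (simp add: centroid_def)
  qed
  moreover have "(\<Sum>i=1..n. dist M (A i) ^ (2 * m))
      = (\<Sum>k<n. cmod (complex_of_vec (M - P) - B 0 * w ^ k) ^ (2 * m))"
  proof -
    have "dist M (A (k mod n + 1)) = cmod (complex_of_vec (M - P) - B 0 * w ^ k)" for k
      using w(1)[of k] unfolding dist_eq_cmod[where P = P] by (simp add: B_def)
    then show ?thesis by (subst sum_shift_cyclic) (simp only:)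
  qed
  moreover have "cmod (complex_of_vec (M - P)) = dist P M"
    by (simp add: cmod_complex_of_vec dist_norm norm_minus_commute)
  ultimately show ?thesis
    using sum_dist_powers_regular[OF w(2,4,3) \<open>m < n\<close>] norm_B by simp
qed

section \<open>The locus\<close>

theorem theorem3p2:
  fixes n m :: nat and R c :: real and A :: "nat \<Rightarrow> real^2"
  assumes "n \<ge> 3"
    and "regular_polygon n A"
    and "R > 0"
    and "has_circumradius n A R"
    and "m \<in> {1..n - 1}"
    and "c > real n * R ^ (2 * m)"
  shows "\<exists>r>0. {M. (\<Sum>i=1..n. dist M (A i) ^ (2 * m)) = c} = sphere (centroid n A) r"
proof -
  have m: "m \<ge> 1" "m < n" using assms by auto
  define g where
    "g t = n * (\<Sum>j\<le>m. real (m choose j) ^ 2 * (t ^ 2) ^ (m - j) * (R ^ 2) ^ j)" for t :: real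
  \<comment> \<open>The term \<open>j = 0\<close> is strictly increasing on \<open>t \<ge> 0\<close>
    since \<open>m \<ge> 1\<close>; the others are only weakly so, the one for \<open>j = m\<close>
    being constant.\<close>
  have split: "g t = n * (t ^ (2 * m)
      + (\<Sum>j\<in>{..m} - {0}. real (m choose j) ^ 2 * (t ^ 2) ^ (m - j) * (R ^ 2) ^ j))" for t
    unfolding g_def by (subst sum.remove[of _ 0]) (simp_all add: power_mult)
  have strict: "g s < g t" if "0 \<le> s" "s < t" for s t
    unfolding split using that m \<open>R > 0\<close>
    by (intro mult_strict_left_mono add_less_le_mono sum_mono mult_mono power_mono
          power_strict_mono) auto
  \<comment> \<open>Only \<open>j = m\<close> survives, through \<open>0 ^ 0 = 1\<close>.\<close>
  have "g 0 = real n * R ^ (2 * m)"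
    unfolding g_def
    by (subst sum.remove[of _ m]) (auto simp: power_mult power_0_left intro!: sum.neutral)
  then have g0: "g 0 < c" using assms by simp
  have "c > 0" using assms(3,6) by (smt (verit) mult_nonneg_nonneg of_nat_0_le_iff zero_le_power)
  \<comment> \<open>Since \<open>c + 1 \<ge> 1\<close>, its powers dominate it; this makes
    \<open>c + 1\<close> an upper end for the intermediate value theorem.\<close>
  have "c \<le> (c + 1) ^ (2 * m)"
    using self_le_power[of "c + 1" "2 * m"] \<open>c > 0\<close> m by simp
  also have "\<dots> \<le> (c + 1) ^ (2 * m)
      + (\<Sum>j\<in>{..m} - {0}. real (m choose j) ^ 2 * ((c + 1) ^ 2) ^ (m - j) * (R ^ 2) ^ j)"
    by (simp add: sum_nonneg)
  also have "\<dots> \<le> g (c + 1)"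
    unfolding split using m
    using mult_right_mono[of 1 "real n"] by (simp add: sum_nonneg)
  finally have gT: "c \<le> g (c + 1)" .
  have "continuous_on {0..c + 1} g"
    unfolding g_def by (intro continuous_intros)
  then obtain r where r: "0 \<le> r" "g r = c"
    using IVT'[of g 0 c "c + 1"] g0 gT \<open>c > 0\<close> by auto
  \<comment> \<open>The strict bound on \<open>c\<close> keeps the locus from shrinking to the
    centroid.\<close>
  have "r \<noteq> 0" using r g0 by auto
  have iff: "g t = c \<longleftrightarrow> t = r" if "t \<ge> 0" for t
    using strict[of t r] strict[of r t] r that by (cases t r rule: linorder_cases) auto
  have "(\<Sum>i=1..n. dist M (A i) ^ (2 * m)) = g (dist (centroid n A) M)" for M
    unfolding g_def using assms m by (intro regular_polygon_power_sum) auto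
  then have "{M. (\<Sum>i=1..n. dist M (A i) ^ (2 * m)) = c} = sphere (centroid n A) r"
    using iff by auto
  then show ?thesis using r \<open>r \<noteq> 0\<close> by (intro exI[of _ r]) auto
qed

end
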